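(* Let $f_{\min}\in\mathbb{R}$ and let $\mathcal{X}=[\mu^L,\mu^U]\times[\sigma^L,\sigma^U]\subset\mathbb{R}\times[0,\infty)$ be a box that contains parts of all four sets $I_1,I_2,I_3,I_4$, i.e. $\mathcal{X}\cap I_j\neq\emptyset$ for $j=1,2,3,4$. Define $f_{\mu^U}:[\sigma^L,\sigma^U]\to[0,1]$ by $f_{\mu^U}(\sigma)=\mathrm{PI}(\mu^U,\sigma)$ and $\tilde f_{\sigma^L}:[\mu^L,\mu^U]\to[0,1]$ by $$\tilde f_{\sigma^L}(\mu)=\begin{cases}\mathrm{PI}(\mu,\sigma^L), & \mu\ge f_{\min},\\ \mathrm{PI}(f_{\min},\sigma^L)+\dfrac{\mathrm{PI}(f_{\min},\sigma^L)-\mathrm{PI}(\mu^L,\sigma^U)}{f_{\min}-\mu^L}\,(\mu-f_{\min}), & \text{otherwise.}\end{cases}$$ Let $f^{cv}_{\mu^U}$ be the convex envelope of $f_{\mu^U}$ on $[\sigma^L,\sigma^U]$ and let $\tilde f^{cv}_{\sigma^L}$ be a convex relaxation of $\tilde f_{\sigma^L}$ on $[\mu^L,\mu^U]$. Then $$\mathrm{PI}^{cv}_{1-4}(\mu,\sigma):=\max\left(\tilde f^{cv}_{\sigma^L}(\mu),\,f^{cv}_{\mu^U}(\sigma)\right)$$ is a convex relaxation of $\mathrm{PI}$ on $\mathcal{X}$: it is convex on $\mathcal{X}$ and $\mathrm{PI}^{cv}_{1-4}(\mu,\sigma)\le\mathrm{PI}(\mu,\sigma)$ for all $(\mu,\s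igma)\in\mathcal{X}$.
   Context: The probability of improvement function $\mathrm{PI}:\mathbb{R}\times[0,\infty)\to\mathbb{R}$ with target $f_{\min}\in\mathbb{R}$ is $$\mathrm{PI}(\mu,\sigma)=\begin{cases}\Phi\!\left(\frac{f_{\min}-\mu}{\sigma}\right), & \sigma>0,\\ 0, & \sigma=0,\ f_{\min}\le\mu,\\ 1, & \sigma=0,\ f_{\min}>\mu,\end{cases}$$ where $\Phi(x)=\int_{-\infty}^x\frac{1}{\sqrt{2\pi}}e^{-t^2/2}\,dt$. The sets are subsets of $\mathbb{R}\times[0,\infty)$: $I_1=\{(\mu,\sigma):\mu\le f_{\min},\ \mu-f_{\min}\ge-\sqrt2\,\sigma\}$, $I_2=\{(\mu,\sigma):\mu\ge f_{\min},\ \mu-f_{\min}\le\sqrt2\,\sigma\}$, $I_3=\{(\mu,\sigma):\mu\le f_{\min},\ \mu-f_{\min}\le-\sqrt2\,\sigma\}$, $I_4=\{(\mu,\sigma):\mu\ge f_{\min},\ \mu-f_{\min}\ge\sqrt2\,\sigma\}$. A convex relaxation of a function $g$ on a convex set $S$ is a convex function on $S$ that is $\le g$ everywhere on $S$. The convex envelope of $g$ on $S$ is the pointwise largest convex relaxation of $g$ on $S$. In the second case of $\tilde f_{\sigma^L}$ one has $\mu<f_{\min}$, hence $\mu^L<f_{\min}$. *)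

theory Defs
  imports "HOL-Probability.Probability"
begin

definition Phi :: "real \<Rightarrow> real" where
  "Phi x = (LBINT t:{..x}. std_normal_density t)"

(* PI is only meaningful for sigma >= 0; for sigma < 0 the value is a junk value. *)
definition PI :: "real \<Rightarrow> real \<Rightarrow> real \<Rightarrow> real" where
  "PI fmin \<mu> \<sigma> =
     (if \<sigma> > 0 then Phi ((fmin - \<mu>) / \<sigma>)
      else if fmin \<le> \<mu> then 0 else 1)"

definition I1 :: "real \<Rightarrow> (real \<times> real) set" where
  "I1 fmin = {(\<mu>, \<sigma>). \<sigma> \<ge> 0 \<and> \<mu> \<le> fmin \<and> \<mu> - fmin \<ge> - sqrt 2 * \<sigma>}"

definition I2 :: "real \<Rightarrow> (real \<times> real) set" where
  "I2 fmin = {(\<mu>, \<sigma>). \<sigma> \<ge> 0 \<and> \<mu> \<ge> fmin \<and> \<mu> - fmin \<le> sqrt 2 * \<sigma>}"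

definition I3 :: "real \<Rightarrow> (real \<times> real) set" where
  "I3 fmin = {(\<mu>, \<sigma>). \<sigma> \<ge> 0 \<and> \<mu> \<le> fmin \<and> \<mu> - fmin \<le> - sqrt 2 * \<sigma>}"

definition I4 :: "real \<Rightarrow> (real \<times> real) set" where
  "I4 fmin = {(\<mu>, \<sigma>). \<sigma> \<ge> 0 \<and> \<mu> \<ge> fmin \<and> \<mu> - fmin \<ge> sqrt 2 * \<sigma>}"

(* convex_on includes convexity of S. *)
definition convex_relaxation_on ::
  "'a::real_vector set \<Rightarrow> ('a \<Rightarrow> real) \<Rightarrow> ('a \<Rightarrow> real) \<Rightarrow> bool" where
  "convex_relaxation_on S g h \<longleftrightarrow> convex_on S h \<and> (\<forall>x\<in>S. h x \<le> g x)"

(* A predicate rather than a function: the envelope is determined only on S. *)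
definition convex_envelope_on ::
  "'a::real_vector set \<Rightarrow> ('a \<Rightarrow> real) \<Rightarrow> ('a \<Rightarrow> real) \<Rightarrow> bool" where
  "convex_envelope_on S g h \<longleftrightarrow>
     convex_relaxation_on S g h \<and>
     (\<forall>k. convex_relaxation_on S g k \<longrightarrow> (\<forall>x\<in>S. k x \<le> h x))"

definition f_muU :: "real \<Rightarrow> real \<Rightarrow> real \<Rightarrow> real" where
  "f_muU fmin \<mu>U \<sigma> = PI fmin \<mu>U \<sigma>"

definition f_tilde_sigmaL :: "real \<Rightarrow> real \<Rightarrow> real \<Rightarrow> real \<Rightarrow> real \<Rightarrow> real" where
  "f_tilde_sigmaL fmin \<mu>L \<sigma>L \<sigma>U \<mu> =
     (if \<mu> \<ge> fmin then PI fmin \<mu> \<sigma>L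
      else PI fmin fmin \<sigma>L
           + (PI fmin fmin \<sigma>L - PI fmin \<mu>L \<sigma>U) / (fmin - \<mu>L) * (\<mu> - fmin))"

end

theory Submission
  imports Defs
begin

text \<open>
  \<open>PI\<close> is nonincreasing in \<open>\<mu>\<close>, so its restriction to \<open>\<mu> = \<mu>U\<close> is a lower bound. In \<open>\<sigma>\<close> it is
  nondecreasing for \<open>\<mu> \<ge> fmin\<close> and nonincreasing for \<open>\<mu> < fmin\<close>. Hence it is bounded below by its
  value at \<open>\<sigma>L\<close> in the first case and at \<open>\<sigma>U\<close> in the second, where \<open>\<mu> \<mapsto> PI \<mu> \<sigma>U\<close> is concave and so
  lies above its chord, which in turn dominates the affine branch of \<open>f_tilde_sigmaL\<close>.
\<close>

lemma set_integrable_std_normal_density: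
  "A \<in> sets borel \<Longrightarrow> set_integrable lborel A std_normal_density"
  unfolding set_integrable_def
  by (rule integrable_mult_indicator) (auto intro: integrable_normal_density)

text \<open>Splits the half-line at \<open>x\<close> and trades the Lebesgue integral for a gauge
  integral over a compact interval, the form that the fundamental theorem of calculus takes.\<close>

lemma Phi_diff:
  assumes "x \<le> y"
  shows "Phi y = Phi x + integral {x..y} std_normal_density"
proof -
  have "{..y} = {..x} \<union> {x<..y}" "{..x} \<inter> {x<..y} = {}" using assms by auto
  then have "Phi y = Phi x + (LBINT t:{x<..y}. std_normal_density t)"
    unfolding Phi_def
    by (simp add: set_integral_Un set_integrable_std_normal_density)
  also have "(LBINT t:{x<..y}. std_normal_density t) = (LBINT t:{x..y}. std_normal_density t)"
    by (rule set_integral_cong_set)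
      (auto simp: set_borel_measurable_def intro!: AE_I[where N = "{x}"])
  also have "\<dots> = integral {x..y} std_normal_density"
    by (intro set_borel_integral_eq_integral(2) set_integrable_std_normal_density) auto
  finally show ?thesis .
qed

lemma mono_Phi: "mono Phi"
  by (rule monoI) (simp add: Phi_diff integral_nonneg set_borel_integral_eq_integral(1)
      set_integrable_std_normal_density)

lemma Phi_nonneg: "0 \<le> Phi x"
  unfolding Phi_def set_lebesgue_integral_def by (rule integral_nonneg_AE) auto

lemma Phi_le_1: "Phi x \<le> 1"
proof -
  have "Phi x \<le> (\<integral>t. std_normal_density t \<partial>lborel)"
    unfolding Phi_def set_lebesgue_integral_def
    using set_integrable_std_normal_density[of "{..x}"]
    by (intro integral_mono) (auto simp: set_integrable_def indicator_def)
  then show ?thesis by simp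
qed

lemma Phi_has_real_derivative: "(Phi has_real_derivative std_normal_density x) (at x)"
proof -
  \<comment> \<open>The bounds \<open>x-1\<close> and \<open>x+1\<close> make \<open>x\<close> an
    interior point, so the derivative within the interval is the two-sided one.\<close>
  have "((\<lambda>y. integral {x-1..y} std_normal_density) has_real_derivative std_normal_density x)
          (at x within {x-1..x+1})"
    by (rule integral_has_real_derivative)
      (auto simp: normal_density_def intro!: continuous_intros)
  then have "((\<lambda>y. Phi (x-1) + integral {x-1..y} std_normal_density)
               has_real_derivative std_normal_density x) (at x)"
    by (simp add: at_within_Icc_at DERIV_add[OF DERIV_const, simplified])
  then show ?thesis
    by (rule has_field_derivative_transform_within_open[where S = "{x-1<..}"])
      (auto intro: Phi_diff[symmetric])
qed

text \<open>The density decreases to the right of 0, so the derivative of \<open>- Phi\<close>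
  increases there.\<close>

lemma concave_on_Phi: "concave_on {0..} Phi"
  unfolding concave_on_def
proof (rule convex_on_realI)
  show "((\<lambda>x. - Phi x) has_real_derivative - std_normal_density x) (at x)" for x
    by (rule DERIV_minus[OF Phi_has_real_derivative])
  show "- std_normal_density x \<le> - std_normal_density y"
    if "x \<in> {0..}" "y \<in> {0..}" "x \<le> y" for x y :: real
    using that by (simp add: std_normal_density_def divide_right_mono power_mono)
qed auto

lemma PI_antimono_mu:
  assumes "\<mu> \<le> \<mu>'"
  shows "PI fmin \<mu>' \<sigma> \<le> PI fmin \<mu> \<sigma>"
  using assms by (auto simp: PI_def intro!: monoD[OF mono_Phi] divide_right_mono)

text \<open>The numerator \<open>fmin - \<mu>\<close> is nonpositive, so the quotient rises as
  \<sigma> > 0 grows; the degenerate value 0 is a lower bound of \<open>Phi\<close>.\<close>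

lemma PI_mono_sigma:
  assumes "fmin \<le> \<mu>" "\<sigma> \<le> \<sigma>'"
  shows "PI fmin \<mu> \<sigma> \<le> PI fmin \<mu> \<sigma>'"
proof (cases "\<sigma> > 0")
  case True
  then show ?thesis
    using assms by (auto simp: PI_def intro!: monoD[OF mono_Phi] divide_left_mono_neg)
next
  case False
  then show ?thesis using assms by (simp add: PI_def Phi_nonneg)
qed

text \<open>Now the numerator is positive, so the quotient falls as \<sigma> > 0 grows; the
  degenerate value 1 is an upper bound of \<open>Phi\<close>.\<close>

lemma PI_antimono_sigma:
  assumes "\<mu> < fmin" "\<sigma> \<le> \<sigma>'"
  shows "PI fmin \<mu> \<sigma>' \<le> PI fmin \<mu> \<sigma>"
proof (cases "\<sigma> > 0")
  case True
  then show ?thesis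
    using assms by (auto simp: PI_def intro!: monoD[OF mono_Phi] divide_left_mono)
next
  case False
  then show ?thesis using assms by (simp add: PI_def Phi_le_1)
qed

lemma PI_chord_le:
  assumes "\<mu>L \<le> \<mu>" "\<mu> < fmin" "\<sigma>L \<le> \<sigma>U"
  shows "PI fmin fmin \<sigma>L + (PI fmin fmin \<sigma>L - PI fmin \<mu>L \<sigma>U) / (fmin - \<mu>L) * (\<mu> - fmin)
         \<le> PI fmin \<mu> \<sigma>U"
proof -
  \<comment> \<open>\<open>t\<close> is the weight of \<open>\<mu>L\<close> in \<mu> = (1 - t) fmin
    + t \<mu>L.\<close>
  define t where "t = (fmin - \<mu>) / (fmin - \<mu>L)"
  have t: "0 \<le> t" "t \<le> 1" "t * (fmin - \<mu>L) = fmin - \<mu>"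
    using assms by (auto simp: t_def divide_simps)
  have "PI fmin fmin \<sigma>L + (PI fmin fmin \<sigma>L - PI fmin \<mu>L \<sigma>U) / (fmin - \<mu>L) * (\<mu> - fmin)
        = (1 - t) * PI fmin fmin \<sigma>L + t * PI fmin \<mu>L \<sigma>U"
  proof -
    have "\<mu> - fmin = (fmin - \<mu>L) * (- t)" using t(3) by (simp add: mult.commute)
    then have slope: "D / (fmin - \<mu>L) * (\<mu> - fmin) = - (t * D)" for D
      using assms by simp
    show ?thesis
      by (simp only: slope) (simp add: algebra_simps)
  qed
  also have "\<dots> \<le> PI fmin \<mu> \<sigma>U"
  proof (cases "\<sigma>U > 0")
    case True
    \<comment> \<open>The left side is \<open>Phi 0\<close> or, for a degenerate
      \<open>\<sigma>L\<close>, 0. So the affine branch starts at \<open>fmin\<close> no higher than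
      the chord of \<open>PI\<close> at level \<open>\<sigma>U\<close>.\<close>
    have "PI fmin fmin \<sigma>L \<le> Phi 0"
      by (simp add: PI_def Phi_nonneg)
    then have "(1 - t) * PI fmin fmin \<sigma>L + t * PI fmin \<mu>L \<sigma>U
               \<le> (1 - t) * Phi 0 + t * Phi ((fmin - \<mu>L) / \<sigma>U)"
      using t True by (simp add: PI_def mult_left_mono)
    also have "\<dots> \<le> Phi (t * ((fmin - \<mu>L) / \<sigma>U))"
      using concave_onD[OF concave_on_Phi, of t 0 "(fmin - \<mu>L) / \<sigma>U"] t True assms by simp
    also have "\<dots> = PI fmin \<mu> \<sigma>U"
      using True t(3) by (simp add: PI_def)
    finally show ?thesis .
  next
    case False
    \<comment> \<open>Here \<open>\<sigma>L\<close> is degenerate too: the value at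
      \<open>fmin\<close> is 0, those at \<open>\<mu>L\<close> and \<mu> are 1, and the claim
      becomes t \<le> 1.\<close>
    then show ?thesis using assms t by (simp add: PI_def)
  qed
  finally show ?thesis .
qed

lemma f_tilde_sigmaL_le_PI:
  assumes "\<mu>L \<le> \<mu>" "\<sigma>L \<le> \<sigma>" "\<sigma> \<le> \<sigma>U"
  shows "f_tilde_sigmaL fmin \<mu>L \<sigma>L \<sigma>U \<mu> \<le> PI fmin \<mu> \<sigma>"
proof (cases "fmin \<le> \<mu>")
  case True
  then show ?thesis using assms by (simp add: f_tilde_sigmaL_def PI_mono_sigma)
next
  case False
  then have "f_tilde_sigmaL fmin \<mu>L \<sigma>L \<sigma>U \<mu> \<le> PI fmin \<mu> \<sigma>U"
    using assms PI_chord_le[of \<mu>L \<mu> fmin \<sigma>L \<sigma>U] by (simp add: f_tilde_sigmaL_def)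
  also have "\<dots> \<le> PI fmin \<mu> \<sigma>"
    using False assms by (intro PI_antimono_sigma) auto
  finally show ?thesis .
qed

text \<open>Each function sees only its own coordinate, and its convexity bound is dominated by the
  same convex combination of the two maxima.\<close>

lemma convex_on_max_Times:
  fixes f :: "'a::real_vector \<Rightarrow> real" and g :: "'b::real_vector \<Rightarrow> real"
  assumes f: "convex_on A f" and g: "convex_on B g"
  shows "convex_on (A \<times> B) (\<lambda>(x, y). max (f x) (g y))"
proof (rule convex_onI)
  show "convex (A \<times> B)"
    using f g by (simp add: convex_on_imp_convex convex_Times)
  fix t :: real and p q :: "'a \<times> 'b"
  assume t: "0 < t" "t < 1" and pq: "p \<in> A \<times> B" "q \<in> A \<times> B"
  obtain x y x' y' where p: "p = (x, y)" and q: "q = (x', y')"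
    by (metis surj_pair)
  have "f ((1 - t) *\<^sub>R x + t *\<^sub>R x') \<le> (1 - t) * f x + t * f x'"
    using convex_onD[OF f] t pq p q by simp
  also have "\<dots> \<le> (1 - t) * max (f x) (g y) + t * max (f x') (g y')"
    using t by (intro add_mono mult_left_mono) auto
  finally have 1: "f ((1 - t) *\<^sub>R x + t *\<^sub>R x') \<le> \<dots>" .
  have "g ((1 - t) *\<^sub>R y + t *\<^sub>R y') \<le> (1 - t) * g y + t * g y'"
    using convex_onD[OF g] t pq p q by simp
  also have "\<dots> \<le> (1 - t) * max (f x) (g y) + t * max (f x') (g y')"
    using t by (intro add_mono mult_left_mono) auto
  finally show "(case (1 - t) *\<^sub>R p + t *\<^sub>R q of (x, y) \<Rightarrow> max (f x) (g y))
      \<le> (1 - t) * (case p of (x, y) \<Rightarrow> max (f x) (g y)) + t * (case q of (x, y) \<Rightarrow> max (f x) (g y))"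
    using 1 by (simp add: p q)
qed

theorem mainTheorem3:
  fixes fmin \<mu>L \<mu>U \<sigma>L \<sigma>U :: real
    and X :: "(real \<times> real) set"
    and f_cv f_tilde_cv :: "real \<Rightarrow> real"
  assumes "\<mu>L \<le> \<mu>U" and "0 \<le> \<sigma>L" and "\<sigma>L \<le> \<sigma>U"
    and "X = {\<mu>L..\<mu>U} \<times> {\<sigma>L..\<sigma>U}"
    and "X \<inter> I1 fmin \<noteq> {}" and "X \<inter> I2 fmin \<noteq> {}"
    and "X \<inter> I3 fmin \<noteq> {}" and "X \<inter> I4 fmin \<noteq> {}"
    and "convex_envelope_on {\<sigma>L..\<sigma>U} (f_muU fmin \<mu>U) f_cv"
    and "convex_relaxation_on {\<mu>L..\<mu>U} (f_tilde_sigmaL fmin \<mu>L \<sigma>L \<sigma>U) f_tilde_cv"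
  shows "convex_relaxation_on X (\<lambda>(\<mu>, \<sigma>). PI fmin \<mu> \<sigma>)
           (\<lambda>(\<mu>, \<sigma>). max (f_tilde_cv \<mu>) (f_cv \<sigma>))"
proof -
  note f = assms(9)[unfolded convex_envelope_on_def convex_relaxation_on_def f_muU_def,
      THEN conjunct1]
  note f_tilde = assms(10)[unfolded convex_relaxation_on_def]
  have "max (f_tilde_cv \<mu>) (f_cv \<sigma>) \<le> PI fmin \<mu> \<sigma>" if "(\<mu>, \<sigma>) \<in> X" for \<mu> \<sigma>
  proof -
    have mem: "\<mu> \<in> {\<mu>L..\<mu>U}" "\<sigma> \<in> {\<sigma>L..\<sigma>U}"
      using that assms(4) by auto
    have "f_tilde_cv \<mu> \<le> f_tilde_sigmaL fmin \<mu>L \<sigma>L \<sigma>U \<mu>"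
      using f_tilde mem by blast
    also have "\<dots> \<le> PI fmin \<mu> \<sigma>"
      using mem by (intro f_tilde_sigmaL_le_PI) auto
    finally have "f_tilde_cv \<mu> \<le> PI fmin \<mu> \<sigma>" .
    \<comment> \<open>The second component is compared with \<open>PI\<close> on the right edge of
      the box, where \<mu> is largest.\<close>
    moreover have "f_cv \<sigma> \<le> PI fmin \<mu>U \<sigma>"
      using f mem by blast
    moreover have "PI fmin \<mu>U \<sigma> \<le> PI fmin \<mu> \<sigma>"
      using mem by (intro PI_antimono_mu) auto
    ultimately show ?thesis by simp
  qed
  moreover have "convex_on X (\<lambda>(\<mu>, \<sigma>). max (f_tilde_cv \<mu>) (f_cv \<sigma>))"
    unfolding assms(4) using f f_tilde by (intro convex_on_max_Times) auto
  ultimately show ?thesis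
    unfolding convex_relaxation_on_def by auto
qed

end
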